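(* Let $\boldsymbol{x}=(\boldsymbol{x}_1,\ldots,\boldsymbol{x}_\ell)$ and $\boldsymbol{y}=(\boldsymbol{y}_1,\ldots,\boldsymbol{y}_\ell)$ be time series in $\mathbb{R}^d$ of common length $\ell\ge 2$, with signature kernel $K:[0,1]^2\to\mathbb{R}$. For each $k,l\in\{1,\ldots,\ell-1\}$, the restricted kernel $\kappa_{k,l}=K|_{T_{k,l}}$ satisfies $$\kappa_{k,l}=\sum_{n=0}^\infty \boldsymbol{T}_{k,l}^{\,n}\Big(\kappa_{k-1,l}^{(\sigma_k,\,\cdot\,)}+\kappa_{k,l-1}^{(\,\cdot\,,\tau_l)}-\kappa_{k-1,l-1}^{(\sigma_k,\tau_l)}\Big)\qquad\text{uniformly on } T_{k,l}.$$ Here, as functions on $T_{k,l}$: $\kappa_{k-1,l}^{(\sigma_k,\,\cdot\,)}$ is the function $(u,v)\mapsto\kappa_{k-1,l}(\sigma_k,v)$, $\kappa_{k,l-1}^{(\,\cdot\,,\tau_l)}$ is the function $(u,v)\mapsto\kappa_{k,l-1}(u,\tau_l)$, and $\kappa_{k-1,l-1}^{(\sigma_k,\tau_l)}$ is the constant function with value $\kappa_{k-1,l-1}(\sigma_k,\tau_l)$; moreover $\kappa_{0,l}:=K|_{T_{0,l}}$, $\kappa_{k,0}:=K|_{T_{k,0}}$ and $\kappa_{0,0}\equiv K(0,0)=1$.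
   Context: Grid and tiles: $\sigma_k:=\frac{k-1}{\ell-1}$, $\tau_l:=\frac{l-1}{\ell-1}$ for $k,l=1,\ldots,\ell$. For $k,l\in\{1,\ldots,\ell-1\}$: $\mathcal{D}_{k,l}:=(\sigma_k,\sigma_{k+1})\times(\tau_l,\tau_{l+1})$, $T_{k,l}:=[\sigma_k,\sigma_{k+1}]\times[\tau_l,\tau_{l+1}]$, and $\mathcal{D}:=\bigcup_{k,l=1}^{\ell-1}\mathcal{D}_{k,l}$. Also $T_{0,l}:=\{0\}\times[\tau_l,\tau_{l+1}]$ and $T_{k,0}:=[\sigma_k,\sigma_{k+1}]\times\{0\}$. Coefficients: with $\Delta_k\boldsymbol{z}:=\boldsymbol{z}_{k+1}-\boldsymbol{z}_k$ and $\langle\cdot,\cdot\rangle$ the Euclidean inner product on $\mathbb{R}^d$, set $\rho_{k,l}:=(\ell-1)^2\langle\Delta_k\boldsymbol{x},\Delta_l\boldsymbol{y}\rangle$ for $k,l\in\{1,\ldots,\ell-1\}$. Define $\rho_{\boldsymbol{x},\boldsymbol{y}}(s,t):=\rho_{k,l}$ for $(s,t)\in\mathcal{D}_{k,l}$ and $\rho_{\boldsymbol{x},\boldsymbol{y}}:=0$ on $[0,1]^2\setminus\mathcal{D}$. (On $\mathcal{D}_{k,l}$ this equals $\langle\hat{\boldsymbol{x}}'(s),\hat{\boldsymbol{y}}'(t)\rangle$, where $\hat{\boldsymbol{x}},\hat{\boldsymbol{y}}:[0,1]\to\mathbb{R}^d$ are the continuous piecewise linear interpolants of $\boldsymbol{x},\boldsymbol{y}$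 on the uniform grid.) Signature kernel: the signature kernel of $\boldsymbol{x}$ and $\boldsymbol{y}$ is the unique continuous function $K:[0,1]^2\to\mathbb{R}$ solving $\frac{\partial^2K}{\partial s\,\partial t}(s,t)=\rho_{\boldsymbol{x},\boldsymbol{y}}(s,t)K(s,t)$ for $(s,t)\in\mathcal{D}$ with $K(0,\cdot)=K(\cdot,0)=1$; equivalently, the unique continuous solution of $K(s,t)=1+\int_0^t\int_0^s\rho_{\boldsymbol{x},\boldsymbol{y}}(u,v)K(u,v)\,\mathrm{d}u\,\mathrm{d}v$ on $[0,1]^2$. Propagation operators: for $k,l\in\{1,\ldots,\ell-1\}$, $\boldsymbol{T}_{k,l}:C(T_{k,l})\to C(T_{k,l})$ is defined on continuous functions by $(\boldsymbol{T}_{k,l}f)(s,t)=\int_{\tau_l}^{t}\int_{\sigma_k}^{s}\rho_{k,l}\,f(u,v)\,\mathrm{d}u\,\mathrm{d}v$; $\boldsymbol{T}_{k,l}^{\,n}$ is its $n$-fold iterate, with $\boldsymbol{T}_{k,l}^{\,0}=\mathrm{id}$. *)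

theory Defs
  imports "HOL-Analysis.Analysis"
begin

text \<open>
  A time series of length \<open>len\<close> in \<open>d\<close>-dimensional Euclidean space is a function
  \<open>x :: nat \<Rightarrow> real ^ 'd\<close> of which only the values at \<open>1, \<dots>, len\<close> are used.  The paper's two grids
  \<open>\<sigma>\<close> and \<open>\<tau>\<close> coincide and are both rendered by \<open>grid\<close>.
\<close>

definition grid :: "nat \<Rightarrow> nat \<Rightarrow> real" where
  "grid len k = (real k - 1) / (real len - 1)"

definition open_tile :: "nat \<Rightarrow> nat \<Rightarrow> nat \<Rightarrow> (real \<times> real) set" where
  "open_tile len k l =
     {grid len k<..<grid len (Suc k)} \<times> {grid len l<..<grid len (Suc l)}"

definition open_tiles :: "nat \<Rightarrow> (real \<times> real) set" where
  "open_tiles len = (\<Union>k\<in>{1..len - 1}. \<Union>l\<in>{1..len - 1}. open_tile len k l)"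

text \<open>
  Index \<open>0\<close> denotes the degenerate side \<open>{0}\<close>, so that \<open>tile len 0 l\<close> and \<open>tile len k 0\<close> lie on the
  axes, and \<open>tile len 0 0 = {(0, 0)}\<close>.
\<close>

definition grid_interval :: "nat \<Rightarrow> nat \<Rightarrow> real set" where
  "grid_interval len k = (if k = 0 then {0} else {grid len k..grid len (Suc k)})"

definition tile :: "nat \<Rightarrow> nat \<Rightarrow> nat \<Rightarrow> (real \<times> real) set" where
  "tile len k l = grid_interval len k \<times> grid_interval len l"

definition increment :: "(nat \<Rightarrow> 'a::real_vector) \<Rightarrow> nat \<Rightarrow> 'a" where
  "increment z k = z (Suc k) - z k"

definition tile_coeff ::
  "nat \<Rightarrow> (nat \<Rightarrow> real ^ 'd) \<Rightarrow> (nat \<Rightarrow> real ^ 'd) \<Rightarrow> nat \<Rightarrow> nat \<Rightarrow> real" where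
  "tile_coeff len x y k l = (real len - 1)\<^sup>2 * (increment x k \<bullet> increment y l)"

text \<open>
  The open tiles are pairwise disjoint, so at most one summand is nonzero: the value is
  \<open>tile_coeff len x y k l\<close> on \<open>open_tile len k l\<close>, and \<open>0\<close> off all open tiles.
\<close>

definition coeff_fun ::
  "nat \<Rightarrow> (nat \<Rightarrow> real ^ 'd) \<Rightarrow> (nat \<Rightarrow> real ^ 'd) \<Rightarrow> real \<times> real \<Rightarrow> real" where
  "coeff_fun len x y p =
     (\<Sum>k\<in>{1..len - 1}. \<Sum>l\<in>{1..len - 1}.
        if p \<in> open_tile len k l then tile_coeff len x y k l else 0)"

text \<open>
  \<open>has_mixed_partial K m s t\<close>: the iterated derivative (first in the second variable, then in the
  first) of \<open>K\<close> exists at \<open>(s, t)\<close> and equals \<open>m\<close>.  The explicit differentiability clause is needed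
  because \<^const>\<open>deriv\<close> is an arbitrary value where no derivative exists.
\<close>

definition has_mixed_partial ::
  "(real \<times> real \<Rightarrow> real) \<Rightarrow> real \<Rightarrow> real \<Rightarrow> real \<Rightarrow> bool" where
  "has_mixed_partial K m s t \<longleftrightarrow>
     (\<forall>\<^sub>F u in nhds s. (\<lambda>v. K (u, v)) field_differentiable at t) \<and>
     ((\<lambda>u. deriv (\<lambda>v. K (u, v)) t) has_real_derivative m) (at s)"

text \<open>
  The signature kernel is characterised as the continuous solution of the Goursat problem on the
  unit square; values of \<open>K\<close> outside the unit square are irrelevant.
\<close>

definition is_signature_kernel ::
  "nat \<Rightarrow> (nat \<Rightarrow> real ^ 'd) \<Rightarrow> (nat \<Rightarrow> real ^ 'd) \<Rightarrow> (real \<times> real \<Rightarrow> real) \<Rightarrow> bool" where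
  "is_signature_kernel len x y K \<longleftrightarrow>
     continuous_on ({0..1} \<times> {0..1}) K \<and>
     (\<forall>(s, t)\<in>open_tiles len. has_mixed_partial K (coeff_fun len x y (s, t) * K (s, t)) s t) \<and>
     (\<forall>t\<in>{0..1}. K (0, t) = 1) \<and>
     (\<forall>s\<in>{0..1}. K (s, 0) = 1)"

definition kernel_on_tile ::
  "nat \<Rightarrow> (real \<times> real \<Rightarrow> real) \<Rightarrow> nat \<Rightarrow> nat \<Rightarrow> real \<times> real \<Rightarrow> real" where
  "kernel_on_tile len K k l = restrict K (tile len k l)"

text \<open>
  Functions on a tile are represented extensionally, i.e. as \<^const>\<open>undefined\<close> off the tile.
\<close>

definition propagation ::
  "nat \<Rightarrow> (nat \<Rightarrow> real ^ 'd) \<Rightarrow> (nat \<Rightarrow> real ^ 'd) \<Rightarrow> nat \<Rightarrow> nat \<Rightarrow>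
     (real \<times> real \<Rightarrow> real) \<Rightarrow> real \<times> real \<Rightarrow> real" where
  "propagation len x y k l f =
     (\<lambda>(s, t)\<in>tile len k l.
        integral {grid len l..t} (\<lambda>v.
          integral {grid len k..s} (\<lambda>u. tile_coeff len x y k l * f (u, v))))"

definition boundary_data ::
  "nat \<Rightarrow> (real \<times> real \<Rightarrow> real) \<Rightarrow> nat \<Rightarrow> nat \<Rightarrow> real \<times> real \<Rightarrow> real" where
  "boundary_data len K k l =
     (\<lambda>(u, v)\<in>tile len k l.
        kernel_on_tile len K (k - 1) l (grid len k, v)
      + kernel_on_tile len K k (l - 1) (u, grid len l)
      - kernel_on_tile len K (k - 1) (l - 1) (grid len k, grid len l))"

end

theory Submission
  imports Defs
begin

text \<open>
  On a closed tile \<open>[a, b] \<times> [c, d]\<close> the coefficient of the Goursat problem is a constant \<open>r\<close>, so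
  integrating the equation once in each variable gives
  \<open>K(s, t) = K(a, t) + K(s, c) - K(a, c) + \<integral>\<^sub>c\<^sup>t \<integral>\<^sub>a\<^sup>s r K(u, v) du dv\<close>
  (\<open>goursat_integral_equation\<close>).  The first three terms are the boundary data \<open>B\<close> and the last is
  the propagation operator \<open>V\<close>, whence \<open>K = B + V K\<close>.  Iterating,
  \<open>K = \<Sum>n<N. V\<^sup>n B + V\<^sup>N K\<close>, and because \<open>V\<close> is a Volterra operator its iterates decay
  factorially in the supremum norm (\<open>volterra_funpow_bound\<close>); the remainder \<open>V\<^sup>N K\<close> therefore tends
  to zero uniformly (\<open>volterra_neumann_series\<close>).

  The delicate point is the integral equation.  The differential equation is known only in the open
  tile; it does not by itself make the first-order derivative \<open>\<partial>K/\<partial>t\<close> continuous in \<open>t\<close>, and it says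
  nothing about that derivative near the sides of the tile.  The argument works with
  differences of \<open>K\<close> at two interior abscissae, whose \<open>t\<close>-derivative is an integral of the
  continuous function \<open>r K\<close>, and reaches the sides by continuity of \<open>K\<close> alone.
\<close>

section \<open>Integrals with a variable upper limit\<close>

text \<open>
  The variable upper limit \<open>s\<close> can be moved into the integrand: continuing \<open>u \<mapsto> f (x, u)\<close> beyond \<open>s\<close>
  by the constant \<open>f (x, s)\<close> gives an integral over the fixed interval \<open>{a..b}\<close>, and the surplus is
  \<open>(b - s) * f (x, s)\<close>.  Continuity in both variables then follows from the theorem for
  parameter-dependent integrands on a fixed interval.
\<close>

lemma continuous_on_indefinite_integral_param:
  fixes f :: "'a::topological_space \<times> real \<Rightarrow> real"
  assumes f: "continuous_on (U \<times> {a..b}) f"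
  shows "continuous_on (U \<times> {a..b}) (\<lambda>(x, s). integral {a..s} (\<lambda>u. f (x, u)))"
proof -
  have stopped: "integral {a..s} (\<lambda>u. f (x, u)) =
      integral {a..b} (\<lambda>u. f (x, min u s)) - (b - s) * f (x, s)"
    if x: "x \<in> U" and s: "s \<in> {a..b}" for x s
  proof -
    have "(\<lambda>u. f (x, min u s)) integrable_on {a..b}"
      using x s by (intro integrable_continuous_real continuous_on_compose2[OF f] continuous_intros) auto
    then have "integral {a..b} (\<lambda>u. f (x, min u s)) =
        integral {a..s} (\<lambda>u. f (x, min u s)) + integral {s..b} (\<lambda>u. f (x, min u s))"
      using s by (simp add: Henstock_Kurzweil_Integration.integral_combine)
    also have "integral {a..s} (\<lambda>u. f (x, min u s)) = integral {a..s} (\<lambda>u. f (x, u))"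
      by (intro integral_cong) auto
    also have "integral {s..b} (\<lambda>u. f (x, min u s)) = integral {s..b} (\<lambda>u. f (x, s))"
      by (intro integral_cong) (auto simp: min_def)
    also have "\<dots> = (b - s) * f (x, s)"
      using s by simp
    finally show ?thesis by simp
  qed
  have "continuous_on (U \<times> {a..b}) (\<lambda>p. integral (cbox a b) (\<lambda>u. f (fst p, min u (snd p))))"
    by (intro integral_continuous_on_param, unfold case_prod_beta,
        intro continuous_on_compose2[OF f] continuous_intros) auto
  then have "continuous_on (U \<times> {a..b})
      (\<lambda>p. integral {a..b} (\<lambda>u. f (fst p, min u (snd p))) - (b - snd p) * f p)"
    by (intro continuous_intros f) simp
  then show ?thesis
    by (rule continuous_on_eq) (auto simp: stopped)
qed

lemma continuous_on_inner_integral: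
  fixes f :: "real \<times> real \<Rightarrow> real"
  assumes f: "continuous_on ({a..b} \<times> {c..d}) f"
  shows "continuous_on ({a..b} \<times> {c..d}) (\<lambda>(s, v). integral {a..s} (\<lambda>u. f (u, v)))"
proof -
  have "continuous_on ({c..d} \<times> {a..b}) (\<lambda>p. f (snd p, fst p))"
    by (intro continuous_on_compose2[OF f] continuous_intros) auto
  then have "continuous_on ({c..d} \<times> {a..b}) (\<lambda>(v, s). integral {a..s} (\<lambda>u. f (u, v)))"
    by (rule continuous_on_indefinite_integral_param[of _ _ _ "\<lambda>p. f (snd p, fst p)", simplified])
  then have "continuous_on ({a..b} \<times> {c..d})
      (\<lambda>p. (\<lambda>(v, s). integral {a..s} (\<lambda>u. f (u, v))) (snd p, fst p))"
    by (rule continuous_on_compose2) (auto intro!: continuous_intros)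
  then show ?thesis
    by (simp add: case_prod_beta)
qed

lemma continuous_on_double_integral:
  fixes f :: "real \<times> real \<Rightarrow> real"
  assumes "continuous_on ({a..b} \<times> {c..d}) f"
  shows "continuous_on ({a..b} \<times> {c..d})
    (\<lambda>(s, t). integral {c..t} (\<lambda>v. integral {a..s} (\<lambda>u. f (u, v))))"
  using continuous_on_indefinite_integral_param[OF continuous_on_inner_integral[OF assms]]
  by simp

lemma inner_integrable:
  fixes f :: "real \<times> real \<Rightarrow> real"
  assumes f: "continuous_on ({a..b} \<times> {c..d}) f" and "s \<in> {a..b}" "v \<in> {c..d}"
  shows "(\<lambda>u. f (u, v)) integrable_on {a..s}"
  using assms(2,3)
  by (intro integrable_continuous_real continuous_on_compose2[OF f] continuous_intros) auto

lemma outer_integrable: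
  fixes f :: "real \<times> real \<Rightarrow> real"
  assumes f: "continuous_on ({a..b} \<times> {c..d}) f" and "s \<in> {a..b}" "t \<in> {c..d}"
  shows "(\<lambda>v. integral {a..s} (\<lambda>u. f (u, v))) integrable_on {c..t}"
  using assms(2,3)
  by (intro integrable_continuous_real
      continuous_on_compose2[OF continuous_on_inner_integral[OF f], of _ "\<lambda>v. (s, v)", simplified]
      continuous_intros) auto

section \<open>From the mixed partial derivative to an integral equation\<close>

text \<open>
  Write \<open>D u v\<close> for the derivative of \<open>K\<close> in its second variable at \<open>(u, v)\<close>, and \<open>H u v\<close> for the
  integral of \<open>m\<close> along the segment from \<open>(a, v)\<close> to \<open>(u, v)\<close>.  Both have the \<open>u\<close>-derivative \<open>m\<close>, so \<open>D - H\<close> depends on \<open>v\<close> only and cancels in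
  the difference of two interior abscissae.  Hence that difference of \<open>K\<close> can be integrated in \<open>v\<close>,
  from the side \<open>v = c\<close> on, by the fundamental theorem of calculus.
\<close>

lemma goursat_integral_equation:
  fixes K m :: "real \<times> real \<Rightarrow> real"
  assumes ab: "a < b"
    and K: "continuous_on ({a..b} \<times> {c..d}) K"
    and m: "continuous_on ({a..b} \<times> {c..d}) m"
    and deriv: "\<And>s t. s \<in> {a<..<b} \<Longrightarrow> t \<in> {c<..<d} \<Longrightarrow> has_mixed_partial K (m (s, t)) s t"
    and s: "s \<in> {a..b}" and t: "t \<in> {c..d}"
  shows "K (s, t) = K (a, t) + K (s, c) - K (a, c) +
    integral {c..t} (\<lambda>v. integral {a..s} (\<lambda>u. m (u, v)))"
proof -
  define D where "D u v = deriv (\<lambda>v. K (u, v)) v" for u v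
  define H where "H u v = integral {a..u} (\<lambda>w. m (w, v))" for u v
  have D: "((\<lambda>v. K (u, v)) has_real_derivative D u v) (at v)"
    if "u \<in> {a<..<b}" "v \<in> {c<..<d}" for u v
    using deriv[OF that] eventually_nhds_x_imp_x
    unfolding has_mixed_partial_def D_def by (metis (mono_tags, lifting) DERIV_deriv_iff_field_differentiable)
  have DH: "D u v - H u v = D u' v - H u' v"
    if u: "u \<in> {a<..<b}" "u' \<in> {a<..<b}" and v: "v \<in> {c<..<d}" for u u' v
  proof (rule DERIV_isconst3[OF ab u])
    fix w assume w: "w \<in> {a<..<b}"
    have "continuous_on {a..b} (\<lambda>w. m (w, v))"
      using v by (intro continuous_on_compose2[OF m] continuous_intros) auto
    then have "((\<lambda>u. H u v) has_real_derivative m (w, v)) (at w within {a..b})"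
      using w unfolding H_def by (intro integral_has_real_derivative) auto
    then have "((\<lambda>u. H u v) has_real_derivative m (w, v)) (at w)"
      using w by (simp add: at_within_Icc_at)
    moreover have "((\<lambda>u. D u v) has_real_derivative m (w, v)) (at w)"
      using deriv[OF w v] by (simp add: has_mixed_partial_def D_def)
    ultimately show "((\<lambda>u. D u v - H u v) has_real_derivative 0) (at w)"
      by (auto intro!: derivative_eq_intros)
  qed
  define F where "F u = K (u, t) - K (u, c) - integral {c..t} (H u)" for u
  have F_open: "F u = F u'" if u: "u \<in> {a<..<b}" "u' \<in> {a<..<b}" for u u'
  proof -
    have "((\<lambda>v. H u v - H u' v) has_integral
        (K (u, t) - K (u', t)) - (K (u, c) - K (u', c))) {c..t}"
    proof (rule fundamental_theorem_of_calculus_interior)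
      show "continuous_on {c..t} (\<lambda>v. K (u, v) - K (u', v))"
        using t u by (intro continuous_intros continuous_on_compose2[OF K]) auto
      fix v assume v: "v \<in> {c<..<t}"
      then have v': "v \<in> {c<..<d}"
        using t by auto
      have "((\<lambda>v. K (u, v) - K (u', v)) has_real_derivative D u v - D u' v) (at v)"
        using D[OF u(1) v'] D[OF u(2) v'] by (rule DERIV_diff)
      also have "D u v - D u' v = H u v - H u' v"
        using DH[OF u v'] by simp
      finally show "((\<lambda>v. K (u, v) - K (u', v)) has_vector_derivative H u v - H u' v) (at v)"
        by (simp add: has_real_derivative_iff_has_vector_derivative)
    qed (use t in auto)
    moreover have "H u integrable_on {c..t}" "H u' integrable_on {c..t}"
      using u t unfolding H_def by (auto intro!: outer_integrable[OF m])
    then have "integral {c..t} (\<lambda>v. H u v - H u' v) = integral {c..t} (H u) - integral {c..t} (H u')"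
      by (rule integral_diff)
    ultimately show ?thesis
      by (simp add: F_def integral_unique)
  qed
  have "continuous_on {a..b} (\<lambda>u. integral {c..t} (H u))"
    using t unfolding H_def
    by (intro continuous_on_compose2[OF continuous_on_double_integral[OF m],
          of _ "\<lambda>u. (u, t)", simplified] continuous_intros) auto
  then have contF: "continuous_on {a..b} F"
    using t unfolding F_def
    by (intro continuous_intros continuous_on_compose2[OF K]) auto
  \<comment> \<open>Constant on the open interval and continuous on its closure: this reaches \<open>a\<close> and \<open>b\<close>.\<close>
  have F: "F u = F ((a + b) / 2)" if "u \<in> {a..b}" for u
  proof (rule continuous_constant_on_closure[of "{a<..<b}" F])
    show "F w = F ((a + b) / 2)" if "w \<in> {a<..<b}" for w
      using that ab by (intro F_open) auto
  qed (use that ab contF in auto)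
  have "F a = F ((a + b) / 2)"
    using ab by (intro F) auto
  with F[OF s] have "F s = F a"
    by (rule trans[OF _ sym])
  then show ?thesis
    by (simp add: F_def H_def[abs_def] algebra_simps)
qed

section \<open>The Neumann series of the Volterra operator\<close>

text \<open>
  The result is extensional so that it coincides, as a function, with the propagation operator of a
  tile; this makes the iterates of the two agree at once.
\<close>

definition volterra ::
  "real \<Rightarrow> real \<Rightarrow> real \<Rightarrow> real \<Rightarrow> real \<Rightarrow> (real \<times> real \<Rightarrow> real) \<Rightarrow> real \<times> real \<Rightarrow> real" where
  "volterra r a b c d f =
     (\<lambda>(s, t)\<in>{a..b} \<times> {c..d}. integral {c..t} (\<lambda>v. integral {a..s} (\<lambda>u. r * f (u, v))))"

lemma volterra_apply:
  "s \<in> {a..b} \<Longrightarrow> t \<in> {c..d} \<Longrightarrow>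
    volterra r a b c d f (s, t) = integral {c..t} (\<lambda>v. integral {a..s} (\<lambda>u. r * f (u, v)))"
  by (simp add: volterra_def)

lemma continuous_on_volterra:
  assumes f: "continuous_on ({a..b} \<times> {c..d}) f"
  shows "continuous_on ({a..b} \<times> {c..d}) (volterra r a b c d f)"
proof -
  have "continuous_on ({a..b} \<times> {c..d}) (\<lambda>p. r * f p)"
    by (intro continuous_intros f)
  from continuous_on_double_integral[OF this] show ?thesis
    by (rule continuous_on_eq) (auto simp: volterra_apply)
qed

lemma continuous_on_volterra_funpow:
  assumes "continuous_on ({a..b} \<times> {c..d}) f"
  shows "continuous_on ({a..b} \<times> {c..d}) ((volterra r a b c d ^^ n) f)"
  by (induction n) (auto intro: assms continuous_on_volterra)

text \<open>
  The identity \<open>h = f + g\<close> is asked for on the rectangle only, since for iterates of the operator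
  all values outside are \<^const>\<open>undefined\<close> and no such identity can be derived there.
\<close>

lemma volterra_add:
  assumes f: "continuous_on ({a..b} \<times> {c..d}) f" and g: "continuous_on ({a..b} \<times> {c..d}) g"
    and h: "\<And>p. p \<in> {a..b} \<times> {c..d} \<Longrightarrow> h p = f p + g p"
    and p: "p \<in> {a..b} \<times> {c..d}"
  shows "volterra r a b c d h p = volterra r a b c d f p + volterra r a b c d g p"
proof -
  obtain s t where p_eq: "p = (s, t)" and s: "s \<in> {a..b}" and t: "t \<in> {c..d}"
    using p by auto
  have rf: "continuous_on ({a..b} \<times> {c..d}) (\<lambda>p. r * f p)"
    and rg: "continuous_on ({a..b} \<times> {c..d}) (\<lambda>p. r * g p)"
    by (intro continuous_intros f g)+
  have "integral {a..s} (\<lambda>u. r * h (u, v)) =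
      integral {a..s} (\<lambda>u. r * f (u, v)) + integral {a..s} (\<lambda>u. r * g (u, v))"
    if "v \<in> {c..t}" for v
  proof -
    have v: "v \<in> {c..d}"
      using that t by auto
    have "integral {a..s} (\<lambda>u. r * h (u, v)) = integral {a..s} (\<lambda>u. r * f (u, v) + r * g (u, v))"
      using s v by (intro integral_cong) (auto simp: h algebra_simps)
    also have "\<dots> = integral {a..s} (\<lambda>u. r * f (u, v)) + integral {a..s} (\<lambda>u. r * g (u, v))"
      by (rule integral_add[OF inner_integrable[OF rf s v] inner_integrable[OF rg s v]])
    finally show ?thesis .
  qed
  then have "integral {c..t} (\<lambda>v. integral {a..s} (\<lambda>u. r * h (u, v))) =
      integral {c..t} (\<lambda>v. integral {a..s} (\<lambda>u. r * f (u, v)) + integral {a..s} (\<lambda>u. r * g (u, v)))"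
    by (intro integral_cong) auto
  also have "\<dots> = integral {c..t} (\<lambda>v. integral {a..s} (\<lambda>u. r * f (u, v)))
      + integral {c..t} (\<lambda>v. integral {a..s} (\<lambda>u. r * g (u, v)))"
    by (rule integral_add[OF outer_integrable[OF rf s t] outer_integrable[OF rg s t]])
  finally show ?thesis
    using s t by (simp add: p_eq volterra_apply)
qed

lemma volterra_funpow_add:
  assumes f: "continuous_on ({a..b} \<times> {c..d}) f" and g: "continuous_on ({a..b} \<times> {c..d}) g"
    and h: "\<And>p. p \<in> {a..b} \<times> {c..d} \<Longrightarrow> h p = f p + g p"
    and p: "p \<in> {a..b} \<times> {c..d}"
  shows "(volterra r a b c d ^^ n) h p =
    (volterra r a b c d ^^ n) f p + (volterra r a b c d ^^ n) g p"
  using p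
proof (induction n arbitrary: p)
  case 0
  then show ?case by (simp add: h)
next
  case (Suc n)
  then show ?case
    using volterra_add[OF continuous_on_volterra_funpow[OF f] continuous_on_volterra_funpow[OF g]
        Suc.IH] by simp
qed

text \<open>
  Only the \<open>t\<close>-integration produces the factorial, through the integral of \<open>(v - c) ^ n\<close>; the
  \<open>s\<close>-integration is estimated crudely by the factor \<open>b - a\<close>.  This loses a second factorial but
  still beats every geometric growth.
\<close>

lemma volterra_funpow_bound:
  assumes f: "continuous_on ({a..b} \<times> {c..d}) f"
    and M: "\<And>p. p \<in> {a..b} \<times> {c..d} \<Longrightarrow> \<bar>f p\<bar> \<le> M"
    and s: "s \<in> {a..b}" and t: "t \<in> {c..d}"
  shows "\<bar>(volterra r a b c d ^^ n) f (s, t)\<bar> \<le> M * (\<bar>r\<bar> * (b - a) * (t - c)) ^ n / fact n"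
  using s t
proof (induction n arbitrary: s t)
  case 0
  then show ?case using M by simp
next
  case (Suc n)
  define g where "g = (volterra r a b c d ^^ n) f"
  define C where "C = M * \<bar>r\<bar> ^ Suc n * (b - a) ^ Suc n / fact n"
  have "continuous_on ({a..b} \<times> {c..d}) g"
    unfolding g_def by (rule continuous_on_volterra_funpow[OF f])
  then have rg: "continuous_on ({a..b} \<times> {c..d}) (\<lambda>p. r * g p)"
    by (intro continuous_intros)
  have M0: "0 \<le> M"
    using M[of "(s, t)"] Suc.prems by (auto intro: order_trans[OF abs_ge_zero])
  have pow: "((\<lambda>v. C * (v - c) ^ n) has_integral C * (t - c) ^ Suc n / Suc n) {c..t}"
  proof -
    have "((\<lambda>v. C * (v - c) ^ Suc n / Suc n) has_vector_derivative C * (v - c) ^ n) (at v within {c..t})" for v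
    proof -
      have "((\<lambda>v. C * (v - c) ^ Suc n / Suc n) has_real_derivative
          C * (Suc n * (v - c) ^ n) / Suc n) (at v within {c..t})"
        by (intro DERIV_cdivide DERIV_cmult, rule DERIV_cong[OF DERIV_power])
           (auto intro!: derivative_eq_intros simp del: of_nat_Suc)
      then show ?thesis
        by (simp add: has_real_derivative_iff_has_vector_derivative del: of_nat_Suc)
    qed
    from fundamental_theorem_of_calculus[OF _ this] show ?thesis
      using Suc.prems by simp
  qed
  have "\<bar>integral {a..s} (\<lambda>u. r * g (u, v))\<bar> \<le> C * (v - c) ^ n" if "v \<in> {c..t}" for v
  proof -
    define B where "B = \<bar>r\<bar> * (M * (\<bar>r\<bar> * (b - a) * (v - c)) ^ n / fact n)"
    have v: "v \<in> {c..d}"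
      using that Suc.prems by auto
    have "norm (integral {a..s} (\<lambda>u. r * g (u, v))) \<le> integral {a..s} (\<lambda>u. B)"
    proof (rule integral_norm_bound_integral[OF inner_integrable[OF rg Suc.prems(1) v]])
      fix u assume "u \<in> {a..s}"
      then have "\<bar>g (u, v)\<bar> \<le> M * (\<bar>r\<bar> * (b - a) * (v - c)) ^ n / fact n"
        unfolding g_def using Suc.prems v by (intro Suc.IH) auto
      then show "norm (r * g (u, v)) \<le> B"
        unfolding B_def by (simp only: real_norm_def abs_mult mult_left_mono abs_ge_zero)
    qed auto
    also have "\<dots> = (s - a) * B"
      using Suc.prems by simp
    also have "\<dots> \<le> (b - a) * B"
      using Suc.prems v M0 unfolding B_def by (intro mult_right_mono) auto
    also have "\<dots> = C * (v - c) ^ n"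
      by (simp add: B_def C_def power_mult_distrib)
    finally show ?thesis by simp
  qed
  then have "norm (integral {c..t} (\<lambda>v. integral {a..s} (\<lambda>u. r * g (u, v))))
      \<le> integral {c..t} (\<lambda>v. C * (v - c) ^ n)"
    using pow
    by (intro integral_norm_bound_integral outer_integrable[OF rg Suc.prems])
       (auto simp: has_integral_integrable)
  also have "\<dots> = M * (\<bar>r\<bar> * (b - a) * (t - c)) ^ Suc n / fact (Suc n)"
    unfolding integral_unique[OF pow] by (simp add: C_def power_mult_distrib mult_ac)
  finally show ?case
    using Suc.prems by (simp add: volterra_apply g_def)
qed

text \<open>
  The remainder after \<open>N\<close> terms is the \<open>N\<close>-th iterate applied to the solution \<open>f\<close> itself, which is
  bounded as a continuous function on a compact rectangle.
\<close>

lemma volterra_neumann_series: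
  assumes f: "continuous_on ({a..b} \<times> {c..d}) f" and g: "continuous_on ({a..b} \<times> {c..d}) g"
    and eq: "\<And>p. p \<in> {a..b} \<times> {c..d} \<Longrightarrow> f p = g p + volterra r a b c d f p"
  shows "uniform_limit ({a..b} \<times> {c..d})
    (\<lambda>N p. \<Sum>n<N. (volterra r a b c d ^^ n) g p) f sequentially"
proof -
  have remainder: "f p = (\<Sum>n<N. (volterra r a b c d ^^ n) g p) + (volterra r a b c d ^^ N) f p"
    if p: "p \<in> {a..b} \<times> {c..d}" for p N
  proof (induction N)
    case (Suc N)
    have "(volterra r a b c d ^^ N) f p =
        (volterra r a b c d ^^ N) g p + (volterra r a b c d ^^ N) (volterra r a b c d f) p"
      by (rule volterra_funpow_add[OF g continuous_on_volterra[OF f] eq p])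
    then show ?case
      using Suc.IH by (simp add: funpow_swap1)
  qed simp
  have "compact (f ` ({a..b} \<times> {c..d}))"
    by (intro compact_continuous_image f compact_Times compact_Icc)
  then obtain M where M: "\<And>p. p \<in> {a..b} \<times> {c..d} \<Longrightarrow> \<bar>f p\<bar> \<le> M"
    by (metis bounded_real compact_imp_bounded imageI)
  define q where "q = \<bar>r\<bar> * (b - a) * (d - c)"
  have "(\<lambda>N. M * (inverse (fact N) * q ^ N)) \<longlonglongrightarrow> M * 0"
    by (intro tendsto_mult_left summable_LIMSEQ_zero summable_exp)
  then have "(\<lambda>N. M * q ^ N / fact N) \<longlonglongrightarrow> 0"
    by (simp add: field_simps)
  show ?thesis
  proof (rule uniform_limitI)
    fix e :: real assume "e > 0"
    from order_tendstoD(2)[OF \<open>(\<lambda>N. M * q ^ N / fact N) \<longlonglongrightarrow> 0\<close> this]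
    show "\<forall>\<^sub>F N in sequentially. \<forall>p\<in>{a..b} \<times> {c..d}.
        dist (\<Sum>n<N. (volterra r a b c d ^^ n) g p) (f p) < e"
    proof (rule eventually_mono, intro ballI)
      fix N p assume N: "M * q ^ N / fact N < e" and p: "p \<in> {a..b} \<times> {c..d}"
      obtain s t where p_eq: "p = (s, t)" and st: "s \<in> {a..b}" "t \<in> {c..d}"
        using p by auto
      have "dist (\<Sum>n<N. (volterra r a b c d ^^ n) g p) (f p) = \<bar>(volterra r a b c d ^^ N) f p\<bar>"
        using remainder[OF p, of N] by (simp add: dist_real_def)
      also have "\<dots> \<le> M * (\<bar>r\<bar> * (b - a) * (t - c)) ^ N / fact N"
        unfolding p_eq by (rule volterra_funpow_bound[OF f M st])
      also have "\<dots> \<le> M * q ^ N / fact N"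
        using st M[OF p] unfolding q_def
        by (intro divide_right_mono mult_left_mono power_mono)
           (auto intro!: mult_left_mono mult_nonneg_nonneg order_trans[OF abs_ge_zero])
      finally show "dist (\<Sum>n<N. (volterra r a b c d ^^ n) g p) (f p) < e"
        using N by simp
    qed
  qed
qed

section \<open>Tiles of the grid\<close>

lemma grid_mono: "len \<ge> 2 \<Longrightarrow> i \<le> j \<Longrightarrow> grid len i \<le> grid len j"
  by (simp add: grid_def divide_right_mono)

lemma grid_less_Suc: "len \<ge> 2 \<Longrightarrow> grid len i < grid len (Suc i)"
  by (simp add: grid_def divide_strict_right_mono)

lemma grid_interval_subset_unit:
  assumes "len \<ge> 2" "k \<in> {1..len - 1}"
  shows "{grid len k..grid len (Suc k)} \<subseteq> {0..1}"
proof -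
  have "grid len 1 = 0" "grid len len = 1"
    using assms by (auto simp: grid_def)
  then show ?thesis
    using grid_mono[of len 1 k] grid_mono[of len "Suc k" len] assms by auto
qed

lemma grid_cell_unique:
  assumes "len \<ge> 2" "s \<in> {grid len i<..<grid len (Suc i)}" "s \<in> {grid len j<..<grid len (Suc j)}"
  shows "i = j"
  using assms grid_mono[of len "Suc i" j] grid_mono[of len "Suc j" i]
  by (cases i j rule: linorder_cases) auto

lemma coeff_fun_open_tile:
  assumes "len \<ge> 2" "k \<in> {1..len - 1}" "l \<in> {1..len - 1}" "p \<in> open_tile len k l"
  shows "coeff_fun len x y p = tile_coeff len x y k l"
proof -
  have "p \<in> open_tile len i j \<longleftrightarrow> i = k \<and> j = l" for i j
    using assms(1,4) grid_cell_unique[of len "fst p" i k] grid_cell_unique[of len "snd p" j l]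
    by (auto simp: open_tile_def)
  then have "coeff_fun len x y p = (\<Sum>i\<in>{1..len - 1}. \<Sum>j\<in>{1..len - 1}.
      if i = k then if j = l then tile_coeff len x y k l else 0 else 0)"
    unfolding coeff_fun_def by (intro sum.cong) auto
  also have "\<dots> = (\<Sum>i\<in>{1..len - 1}. if i = k then tile_coeff len x y k l else 0)"
    using assms(3) by (intro sum.cong) auto
  finally show ?thesis
    using assms(2) by simp
qed

lemma tile_eq:
  "k \<ge> 1 \<Longrightarrow> l \<ge> 1 \<Longrightarrow>
    tile len k l = {grid len k..grid len (Suc k)} \<times> {grid len l..grid len (Suc l)}"
  by (simp add: tile_def grid_interval_def)

lemma propagation_eq_volterra:
  "k \<ge> 1 \<Longrightarrow> l \<ge> 1 \<Longrightarrow> propagation len x y k l =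
    volterra (tile_coeff len x y k l) (grid len k) (grid len (Suc k)) (grid len l) (grid len (Suc l))"
  by (rule ext) (simp add: propagation_def volterra_def tile_eq)

text \<open>
  Adjacent tiles share a side, so the restrictions in the boundary data are evaluated inside their
  domains.  For \<open>k = 1\<close> the preceding interval is the degenerate \<open>{0}\<close>, and it is met because the
  grid starts at \<open>0\<close>.
\<close>

lemma grid_in_previous_interval:
  "len \<ge> 2 \<Longrightarrow> k \<ge> 1 \<Longrightarrow> grid len k \<in> grid_interval len (k - 1)"
  using grid_less_Suc[of len "k - 1"]
  by (cases "k = 1") (auto simp: grid_interval_def grid_def[of _ "Suc 0"] less_imp_le)

lemma boundary_data_apply:
  assumes "len \<ge> 2" "k \<ge> 1" "l \<ge> 1" "(u, v) \<in> tile len k l"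
  shows "boundary_data len K k l (u, v) =
    K (grid len k, v) + K (u, grid len l) - K (grid len k, grid len l)"
  using assms grid_in_previous_interval[of len k] grid_in_previous_interval[of len l]
  by (simp add: boundary_data_def kernel_on_tile_def tile_def)

theorem proposition2p5:
  fixes x y :: "nat \<Rightarrow> real ^ 'd"
    and K :: "real \<times> real \<Rightarrow> real"
    and len k l :: nat
  assumes "len \<ge> 2"
    and "is_signature_kernel len x y K"
    and "k \<in> {1..len - 1}"
    and "l \<in> {1..len - 1}"
  shows "uniform_limit (tile len k l)
           (\<lambda>N p. \<Sum>n<N. (propagation len x y k l ^^ n) (boundary_data len K k l) p)
           (kernel_on_tile len K k l)
           sequentially"
proof -
  define a b c d where "a = grid len k" and "b = grid len (Suc k)"
    and "c = grid len l" and "d = grid len (Suc l)"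
  define r where "r = tile_coeff len x y k l"
  have kl: "k \<ge> 1" "l \<ge> 1"
    using assms(3,4) by auto
  have tile: "tile len k l = {a..b} \<times> {c..d}"
    using kl by (simp add: tile_eq a_def b_def c_def d_def)
  have "a < b" "c < d"
    unfolding a_def b_def c_def d_def using assms(1) by (auto intro: grid_less_Suc)
  have "{a..b} \<subseteq> {0..1}" "{c..d} \<subseteq> {0..1}"
    unfolding a_def b_def c_def d_def by (rule grid_interval_subset_unit[OF assms(1)], fact)+
  then have "{a..b} \<times> {c..d} \<subseteq> {0..1} \<times> {0..1}"
    by (rule Sigma_mono)
  moreover have "continuous_on ({0..1} \<times> {0..1}) K"
    using assms(2) by (simp add: is_signature_kernel_def)
  ultimately have K: "continuous_on ({a..b} \<times> {c..d}) K"
    by (rule continuous_on_subset[rotated])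
  have "has_mixed_partial K (r * K (s, t)) s t" if "s \<in> {a<..<b}" "t \<in> {c<..<d}" for s t
  proof -
    have st: "(s, t) \<in> open_tile len k l"
      using that by (simp add: open_tile_def a_def b_def c_def d_def)
    then have "(s, t) \<in> open_tiles len"
      using assms(3,4) unfolding open_tiles_def by blast
    then have "has_mixed_partial K (coeff_fun len x y (s, t) * K (s, t)) s t"
      using assms(2) unfolding is_signature_kernel_def by blast
    then show ?thesis
      by (simp add: coeff_fun_open_tile[OF assms(1,3,4) st] r_def)
  qed
  then have goursat: "K (s, t) = K (a, t) + K (s, c) - K (a, c) +
      integral {c..t} (\<lambda>v. integral {a..s} (\<lambda>u. r * K (u, v)))"
    if "s \<in> {a..b}" "t \<in> {c..d}" for s t
    by (intro goursat_integral_equation[OF \<open>a < b\<close> K, where m = "\<lambda>p. r * K p"]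
        continuous_intros K that)
  define B where "B = boundary_data len K k l"
  have B: "B (s, t) = K (a, t) + K (s, c) - K (a, c)" if "s \<in> {a..b}" "t \<in> {c..d}" for s t
    using boundary_data_apply[OF assms(1) kl, of s t K] that
    by (simp add: tile B_def a_def[symmetric] c_def[symmetric])
  have "continuous_on ({a..b} \<times> {c..d}) (\<lambda>p. K (a, snd p) + K (fst p, c) - K (a, c))"
    using \<open>a < b\<close> \<open>c < d\<close>
    by (intro continuous_intros continuous_on_compose2[OF K]) auto
  then have contB: "continuous_on ({a..b} \<times> {c..d}) B"
    by (rule continuous_on_eq) (auto simp: B)
  have "K p = B p + volterra r a b c d K p" if p: "p \<in> {a..b} \<times> {c..d}" for p
  proof -
    obtain s t where p_eq: "p = (s, t)" and st: "s \<in> {a..b}" "t \<in> {c..d}"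
      using p by auto
    show ?thesis
      unfolding p_eq B[OF st] volterra_apply[OF st] by (rule goursat[OF st])
  qed
  then have "uniform_limit ({a..b} \<times> {c..d})
      (\<lambda>N p. \<Sum>n<N. (volterra r a b c d ^^ n) B p) K sequentially"
    by (rule volterra_neumann_series[OF K contB])
  moreover have "propagation len x y k l = volterra r a b c d"
    unfolding r_def a_def b_def c_def d_def by (rule propagation_eq_volterra[OF kl])
  ultimately have "uniform_limit (tile len k l)
      (\<lambda>N p. \<Sum>n<N. (propagation len x y k l ^^ n) (boundary_data len K k l) p) K sequentially"
    unfolding tile B_def by simp
  moreover have "K p = kernel_on_tile len K k l p" if "p \<in> tile len k l" for p
    using that by (simp add: kernel_on_tile_def)
  ultimately show ?thesis
    by (rule uniform_limit_cong'[OF refl, THEN iffD1, rotated])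
qed

end
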